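(* Let $X$ be a chain and let $\alpha,\beta\in\mathcal{OP}(X)$. Then $\alpha\,\mathcal{D}\,\beta$ in $\mathcal{OP}(X)$ if and only if there exists a bijective mapping $\theta:\mathrm{Im}(\alpha)\to\mathrm{Im}(\beta)$ which is bicompletable in $\mathcal{OP}(X)$.
   Context: $X$ is a chain (totally ordered set), finite or infinite. Maps are written on the right and composed from left to right: $x(\alpha\beta)=(x\alpha)\beta$. A full transformation $\alpha:X\to X$ is orientation-preserving if it is the empty transformation (only when $X=\emptyset$) or there exists a non-empty subset $Y$ of $X$ such that: (OP1) $\alpha$ is order-preserving (i.e. $x\le y$ implies $x\alpha\le y\alpha$) both on $Y$ and on $X\setminus Y$; (OP2) for all $a\in Y$ and $b\in X\setminus Y$, $a\le b$ and $a\alpha\ge b\alpha$. $\mathcal{OP}(X)$ is the monoid, under composition, of all orientation-preserving full transformations of $X$. Green's relations on a monoid $S$: $\alpha\,\mathcal{L}\,\beta$ iff $S\alpha=S\beta$; $\alpha\,\mathcal{R}\,\beta$ iff $\alpha S=\beta S$; $\alpha\,\mathcal{D}\,\beta$ iff there is $\gamma\in S$ with $\alpha\,\mathcal{R}\,\gamma$ and $\gamma\,\mathcal{L}\,\beta$. For $A,B\subseteq X$, a mapping $\theta:A\to B$ is completable in $\mathcal{OP}(X)$ if there exists $\gamma\in\mathcal{OP}(X)$ with $x\gamma=x\theta$ for all $x\in A$. A bijection $\theta:A\to B$ is bicompletable in $\mathcal{OP}(X)$ if both $\theta$ and its inverse $\theta^{-1}:B\to A$ are completable in $\mathcal{OP}(X)$.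 *)

theory Defs
  imports "HOL-Algebra.Coset" "HOL-Library.FuncSet"
begin

text \<open>A chain is a set \<open>X\<close> in a linearly ordered type, with the induced order; this admits the
  empty chain. Full transformations of \<open>X\<close> are the extensional functions \<open>X \<rightarrow>\<^sub>E X\<close>, so
  that equality of functions is equality of transformations; for \<open>X = {}\<close> the only one is the
  empty transformation.\<close>

definition orientation_preserving :: "'a::linorder set \<Rightarrow> ('a \<Rightarrow> 'a) \<Rightarrow> bool" where
  "orientation_preserving X \<alpha> \<longleftrightarrow>
     X = {} \<or>
     (\<exists>Y. Y \<noteq> {} \<and> Y \<subseteq> X \<and>
        mono_on Y \<alpha> \<and> mono_on (X - Y) \<alpha> \<and>
        (\<forall>a\<in>Y. \<forall>b\<in>X - Y. a \<le> b \<and> \<alpha> a \<ge> \<alpha> b))"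

text \<open>Maps act on the right: the product of \<open>\<alpha>\<close> and \<open>\<beta>\<close> applies \<open>\<alpha>\<close> first.\<close>

definition OP :: "'a::linorder set \<Rightarrow> ('a \<Rightarrow> 'a) monoid" where
  "OP X = \<lparr>carrier = {\<alpha> \<in> X \<rightarrow>\<^sub>E X. orientation_preserving X \<alpha>},
           mult = (\<lambda>\<alpha> \<beta>. compose X \<beta> \<alpha>),
           one = (\<lambda>x\<in>X. x)\<rparr>"

text \<open>The library's coset operations give the principal one-sided ideals of a monoid:
  \<open>carrier S #>\<^bsub>S\<^esub> a\<close> is \<open>S a\<close> and \<open>a <#\<^bsub>S\<^esub> carrier S\<close> is \<open>a S\<close>.\<close>

definition green_L :: "('a, 'b) monoid_scheme \<Rightarrow> 'a \<Rightarrow> 'a \<Rightarrow> bool" where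
  "green_L S a b \<longleftrightarrow> carrier S #>\<^bsub>S\<^esub> a = carrier S #>\<^bsub>S\<^esub> b"

definition green_R :: "('a, 'b) monoid_scheme \<Rightarrow> 'a \<Rightarrow> 'a \<Rightarrow> bool" where
  "green_R S a b \<longleftrightarrow> a <#\<^bsub>S\<^esub> carrier S = b <#\<^bsub>S\<^esub> carrier S"

definition green_D :: "('a, 'b) monoid_scheme \<Rightarrow> 'a \<Rightarrow> 'a \<Rightarrow> bool" where
  "green_D S a b \<longleftrightarrow> (\<exists>c\<in>carrier S. green_R S a c \<and> green_L S c b)"

text \<open>A mapping \<open>\<theta> : A \<rightarrow> B\<close> is represented by any function whose restriction to \<open>A\<close> it is;
  values outside \<open>A\<close> play no role.\<close>

definition completable :: "'a::linorder set \<Rightarrow> 'a set \<Rightarrow> 'a set \<Rightarrow> ('a \<Rightarrow> 'a) \<Rightarrow> bool" where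
  "completable X A B \<theta> \<longleftrightarrow>
     A \<subseteq> X \<and> B \<subseteq> X \<and> \<theta> \<in> A \<rightarrow> B \<and> (\<exists>\<gamma>\<in>carrier (OP X). \<forall>x\<in>A. \<gamma> x = \<theta> x)"

definition bicompletable :: "'a::linorder set \<Rightarrow> 'a set \<Rightarrow> 'a set \<Rightarrow> ('a \<Rightarrow> 'a) \<Rightarrow> bool" where
  "bicompletable X A B \<theta> \<longleftrightarrow>
     bij_betw \<theta> A B \<and> completable X A B \<theta> \<and> completable X B A (inv_into A \<theta>)"

lemma orientation_preserving_compose:
  assumes a: "\<alpha> \<in> X \<rightarrow>\<^sub>E X" "orientation_preserving X \<alpha>"
    and b: "\<beta> \<in> X \<rightarrow>\<^sub>E X" "orientation_preserving X \<beta>"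
  shows "orientation_preserving X (compose X \<beta> \<alpha>)"
proof (cases "X = {}")
  case False
  obtain Y where Y: "Y \<noteq> {}" "Y \<subseteq> X" "mono_on Y \<alpha>" "mono_on (X - Y) \<alpha>"
      "\<And>a b. a \<in> Y \<Longrightarrow> b \<in> X - Y \<Longrightarrow> a \<le> b \<and> \<alpha> b \<le> \<alpha> a"
    using a(2) False unfolding orientation_preserving_def by blast
  obtain Z where Z: "Z \<noteq> {}" "Z \<subseteq> X" "mono_on Z \<beta>" "mono_on (X - Z) \<beta>"
      "\<And>a b. a \<in> Z \<Longrightarrow> b \<in> X - Z \<Longrightarrow> a \<le> b \<and> \<beta> b \<le> \<beta> a"
    using b(2) False unfolding orientation_preserving_def by blast
  have aX: "\<And>x. x \<in> X \<Longrightarrow> \<alpha> x \<in> X" using a(1) by auto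
  have mY: "\<alpha> x \<le> \<alpha> y" if "x \<in> Y" "y \<in> Y" "x \<le> y" for x y
    using Y(3) that by (auto simp: mono_on_def)
  have mY': "\<alpha> x \<le> \<alpha> y" if "x \<in> X - Y" "y \<in> X - Y" "x \<le> y" for x y
    using Y(4) that by (auto simp: mono_on_def)
  have mZ: "\<beta> x \<le> \<beta> y" if "x \<in> Z" "y \<in> Z" "x \<le> y" for x y
    using Z(3) that by (auto simp: mono_on_def)
  have mZ': "\<beta> x \<le> \<beta> y" if "x \<in> X - Z" "y \<in> X - Z" "x \<le> y" for x y
    using Z(4) that by (auto simp: mono_on_def)
  have dZ: "x \<in> Z" if "x \<in> X" "y \<in> Z" "x \<le> y" for x y
    using Z(5)[of y x] that by (metis DiffI antisym)
  have dY: "x \<in> Y" if "x \<in> X" "y \<in> Y" "x \<le> y" for x y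
    using Y(5)[of y x] that by (metis DiffI antisym)
  have key: "orientation_preserving X (compose X \<beta> \<alpha>)"
    if W: "W \<subseteq> X"
      "\<And>x y. x \<in> W \<Longrightarrow> y \<in> W \<Longrightarrow> x \<le> y \<Longrightarrow> \<beta> (\<alpha> x) \<le> \<beta> (\<alpha> y)"
      "\<And>x y. x \<in> X - W \<Longrightarrow> y \<in> X - W \<Longrightarrow> x \<le> y \<Longrightarrow> \<beta> (\<alpha> x) \<le> \<beta> (\<alpha> y)"
      "\<And>x y. x \<in> W \<Longrightarrow> y \<in> X - W \<Longrightarrow> x \<le> y \<and> \<beta> (\<alpha> y) \<le> \<beta> (\<alpha> x)" for W
  proof -
    have sub: "mono_on A (compose X \<beta> \<alpha>)" if "A \<subseteq> X"
      "\<And>x y. x \<in> A \<Longrightarrow> y \<in> A \<Longrightarrow> x \<le> y \<Longrightarrow> \<beta> (\<alpha> x) \<le> \<beta> (\<alpha> y)" for A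
      using that by (auto simp: mono_on_def compose_def subset_iff)
    show ?thesis
    proof (cases "W = {}")
      case True
      then have "mono_on X (compose X \<beta> \<alpha>)" using W(3) by (intro sub) auto
      then show ?thesis using False unfolding orientation_preserving_def
        by (intro disjI2 exI[of _ X]) (auto simp: mono_on_def)
    next
      case nW: False
      have "mono_on W (compose X \<beta> \<alpha>)" using W(1,2) by (intro sub)
      moreover have "mono_on (X - W) (compose X \<beta> \<alpha>)" using W(3) by (intro sub) auto
      ultimately show ?thesis unfolding orientation_preserving_def using W(1,4) nW
        by (intro disjI2 exI[of _ W]) (auto simp: compose_def subset_iff)
    qed
  qed
  show ?thesis
  proof (cases "\<exists>x\<in>Y. \<alpha> x \<in> Z")
    case True
    then have Y'Z: "\<alpha> x \<in> Z" if "x \<in> X - Y" for x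
      using that Y(5) dZ aX by blast
    show ?thesis
    proof (rule key[of "{x \<in> Y. \<alpha> x \<in> Z}"])
      fix x y assume xy: "x \<in> X - {x \<in> Y. \<alpha> x \<in> Z}" "y \<in> X - {x \<in> Y. \<alpha> x \<in> Z}" "x \<le> y"
      then show "\<beta> (\<alpha> x) \<le> \<beta> (\<alpha> y)"
        by (metis (no_types, lifting) DiffD1 DiffD2 DiffI Y'Z Z(5) aX dY mY mY' mZ mZ' mem_Collect_eq)
    next
      fix x y assume xy: "x \<in> {x \<in> Y. \<alpha> x \<in> Z}" "y \<in> X - {x \<in> Y. \<alpha> x \<in> Z}"
      then show "x \<le> y \<and> \<beta> (\<alpha> y) \<le> \<beta> (\<alpha> x)"
      proof (cases "y \<in> Y")
        case True
        then show ?thesis using xy Z(5)[of "\<alpha> x" "\<alpha> y"] aX mY[of y x]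
          by (metis (no_types, lifting) DiffD1 DiffD2 DiffI dZ linear mem_Collect_eq)
      next
        case False
        then show ?thesis using xy Y(5)[of x y] Y'Z[of y] mZ by auto
      qed
    qed (use Y(2) mY mZ in auto)
  next
    case no: False
    show ?thesis
    proof (rule key[of "Y \<union> {x \<in> X. \<alpha> x \<in> Z}"])
      fix x y assume xy: "x \<in> Y \<union> {x \<in> X. \<alpha> x \<in> Z}" "y \<in> Y \<union> {x \<in> X. \<alpha> x \<in> Z}" "x \<le> y"
      then show "\<beta> (\<alpha> x) \<le> \<beta> (\<alpha> y)"
        using no Y(2) by (smt (verit) DiffI UnE Z(5) aX dY mY mY' mZ mZ' mem_Collect_eq subset_iff)
    next
      fix x y assume xy: "x \<in> X - (Y \<union> {x \<in> X. \<alpha> x \<in> Z})" "y \<in> X - (Y \<union> {x \<in> X. \<alpha> x \<in> Z})" "x \<le> y"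
      then show "\<beta> (\<alpha> x) \<le> \<beta> (\<alpha> y)" using mY' mZ' aX by auto
    next
      fix x y assume xy: "x \<in> Y \<union> {x \<in> X. \<alpha> x \<in> Z}" "y \<in> X - (Y \<union> {x \<in> X. \<alpha> x \<in> Z})"
      then show "x \<le> y \<and> \<beta> (\<alpha> y) \<le> \<beta> (\<alpha> x)"
      proof (cases "x \<in> Y")
        case True
        then show ?thesis using xy Y(2) Y(5)[of x y] no mZ'[of "\<alpha> y" "\<alpha> x"] aX by auto
      next
        case False
        then show ?thesis using xy Z(5)[of "\<alpha> x" "\<alpha> y"] aX mY'[of y x]
          by (metis (no_types, lifting) DiffI DiffD1 DiffD2 UnCI UnE dZ linear mem_Collect_eq)
      qed
    qed (use Y(2) in auto)
  qed
qed (simp add: orientation_preserving_def)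

lemma monoid_OP: "monoid (OP X)"
proof (rule monoidI)
  show "\<one>\<^bsub>OP X\<^esub> \<in> carrier (OP X)"
  proof -
    have "orientation_preserving X (\<lambda>x\<in>X. x)"
      unfolding orientation_preserving_def
      by (cases "X = {}") (auto intro!: exI[of _ X] simp: mono_on_def)
    then show ?thesis by (auto simp: OP_def)
  qed
next
  fix f g assume "f \<in> carrier (OP X)" "g \<in> carrier (OP X)"
  then show "f \<otimes>\<^bsub>OP X\<^esub> g \<in> carrier (OP X)"
    using orientation_preserving_compose[of f X g]
    by (auto simp: OP_def compose_def)
next
  fix f g h assume "f \<in> carrier (OP X)" "g \<in> carrier (OP X)" "h \<in> carrier (OP X)"
  then show "f \<otimes>\<^bsub>OP X\<^esub> g \<otimes>\<^bsub>OP X\<^esub> h = f \<otimes>\<^bsub>OP X\<^esub> (g \<otimes>\<^bsub>OP X\<^esub> h)"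
    by (auto simp: OP_def compose_def fun_eq_iff restrict_def)
next
  fix f assume "f \<in> carrier (OP X)"
  then show "\<one>\<^bsub>OP X\<^esub> \<otimes>\<^bsub>OP X\<^esub> f = f" "f \<otimes>\<^bsub>OP X\<^esub> \<one>\<^bsub>OP X\<^esub> = f"
    by (auto simp: OP_def compose_def fun_eq_iff restrict_def PiE_def extensional_def Pi_def)
qed

end

theory Submission
  imports Defs
begin

text \<open>If \<open>\<gamma>\<close> is \<open>\<R>\<close>-related to \<open>\<alpha>\<close>, then the two multipliers \<open>v\<close> and \<open>u\<close> with
  \<open>\<gamma> = \<alpha> v\<close> and \<open>\<alpha> = \<gamma> u\<close> act on the images of \<open>\<alpha>\<close> and \<open>\<gamma>\<close> as mutually inverse bijections;
  conversely, multiplying \<open>\<alpha>\<close> by a completion of a bicompletable bijection \<open>\<theta>\<close> produces such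
  a \<open>\<gamma>\<close>, whose image is the range of \<open>\<theta>\<close>. So everything comes down to the fact that \<open>\<L>\<close> is
  equality of images (\<open>green_L_OP_iff\<close>).

  For that, the point is to write \<open>\<alpha> = \<delta> \<beta>\<close> whenever the image of \<open>\<alpha>\<close> is contained in that
  of \<open>\<beta>\<close>. One follows \<open>\<alpha>\<close> by a section of \<open>\<beta>\<close>, that is, a map choosing a preimage under \<open>\<beta>\<close>
  of each point of its image. A section that prefers preimages in the
  lower piece \<open>Y\<close> of the domain of \<open>\<beta>\<close> preserves orientation
  (\<open>cut_monotone_section\<close>). It need not extend to an orientation-preserving
  transformation of the whole chain, since the chain may lack the suprema needed for
  this. Hence \<open>\<delta>\<close> is not obtained as a product inside the monoid, and closure under composition
  is required for orientation-preserving maps between arbitrary subsets of chains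
  (\<open>cut_monotone_comp\<close>).\<close>

section \<open>Orientation-preserving maps between subsets of chains\<close>

text \<open>Allowing the lower piece \<open>Y\<close> to be empty as well as to be all of \<open>A\<close> makes the empty domain
  an ordinary case and removes a case distinction wherever a cut has to be exhibited.\<close>

definition cut_monotone :: "'a::linorder set \<Rightarrow> ('a \<Rightarrow> 'b::linorder) \<Rightarrow> bool" where
  "cut_monotone A f \<longleftrightarrow>
     (\<exists>Y\<subseteq>A. mono_on Y f \<and> mono_on (A - Y) f \<and> (\<forall>a\<in>Y. \<forall>b\<in>A - Y. a \<le> b \<and> f b \<le> f a))"

lemma orientation_preserving_iff_cut_monotone:
  "orientation_preserving X f \<longleftrightarrow> cut_monotone X f"
proof (cases "X = {}")
  case True
  then show ?thesis by (simp add: orientation_preserving_def cut_monotone_def)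
next
  case False
  have "mono_on X f \<Longrightarrow> orientation_preserving X f"
    using False unfolding orientation_preserving_def by (intro disjI2 exI[of _ X]) simp
  then have "orientation_preserving X f" if "cut_monotone X f"
    using that False unfolding cut_monotone_def orientation_preserving_def
    by (metis Diff_empty)
  moreover have "cut_monotone X f" if "orientation_preserving X f"
    using that False unfolding cut_monotone_def orientation_preserving_def by blast
  ultimately show ?thesis by blast
qed

text \<open>Let \<open>Y\<close> and \<open>Z\<close> be the lower pieces of cuts of \<open>A\<close> for \<open>f\<close> and of \<open>B\<close> for \<open>g\<close>.
  There are two candidates for a descent of the composite: the end of \<open>Y\<close>, where \<open>f\<close> drops, and
  a point where \<open>f\<close> climbs out of \<open>Z\<close>, so that \<open>g\<close> drops. Only one descent survives. If
  \<open>f\<close> takes a value in \<open>Z\<close> on \<open>Y\<close>, then all its values on \<open>A - Y\<close> are smaller and thus in \<open>Z\<close>: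
  the composite descends where \<open>f\<close> leaves \<open>Z\<close> inside \<open>Y\<close> and rises again at the end of \<open>Y\<close>, or,
  if \<open>f\<close> does not leave \<open>Z\<close> there, it descends at the end of \<open>Y\<close>. If \<open>f\<close> avoids \<open>Z\<close> on \<open>Y\<close>, then the composite
  rises at the end of \<open>Y\<close> in case \<open>f\<close> drops into \<open>Z\<close>, and descends when \<open>f\<close> leaves \<open>Z\<close>
  after that; in case \<open>f\<close> does not reach \<open>Z\<close>, it descends at the end of \<open>Y\<close>.\<close>

lemma cut_monotone_comp:
  assumes f: "cut_monotone A f" and g: "cut_monotone B g" and fAB: "f \<in> A \<rightarrow> B"
  shows "cut_monotone A (g \<circ> f)"
proof -
  obtain Y where Y: "Y \<subseteq> A" "mono_on Y f" "mono_on (A - Y) f"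
    and Yc: "\<And>a b. a \<in> Y \<Longrightarrow> b \<in> A \<Longrightarrow> b \<notin> Y \<Longrightarrow> a \<le> b \<and> f b \<le> f a"
    using f unfolding cut_monotone_def by blast
  obtain Z where Z: "Z \<subseteq> B" "mono_on Z g" "mono_on (B - Z) g"
    and Zc: "\<And>a b. a \<in> Z \<Longrightarrow> b \<in> B \<Longrightarrow> b \<notin> Z \<Longrightarrow> a \<le> b \<and> g b \<le> g a"
    using g unfolding cut_monotone_def by blast
  have fB: "f x \<in> B" if "x \<in> A" for x using fAB that by auto
  have fmono: "f x \<le> f y" if "x \<in> A" "y \<in> A" "x \<in> Y \<longleftrightarrow> y \<in> Y" "x \<le> y" for x y
    using Y that by (auto simp: mono_on_def)
  have gmono: "g x \<le> g y" if "x \<in> B" "y \<in> B" "x \<in> Z \<longleftrightarrow> y \<in> Z" "x \<le> y" for x y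
    using Z that by (auto simp: mono_on_def)
  have Ydown: "x \<in> Y" if "x \<in> A" "y \<in> Y" "x \<le> y" for x y
    using Yc[of y x] that by force
  have Zdown: "x \<in> Z" if "x \<in> B" "y \<in> Z" "x \<le> y" for x y
    using Zc[of y x] that by force
  have cutI: "cut_monotone A (g \<circ> f)"
    if "W \<subseteq> A"
      "\<And>x y. x \<in> A \<Longrightarrow> y \<in> A \<Longrightarrow> x \<in> W \<longleftrightarrow> y \<in> W \<Longrightarrow> x \<le> y \<Longrightarrow> g (f x) \<le> g (f y)"
      "\<And>x y. x \<in> W \<Longrightarrow> y \<in> A \<Longrightarrow> y \<notin> W \<Longrightarrow> x \<le> y \<and> g (f y) \<le> g (f x)" for W
    unfolding cut_monotone_def using that
    by (intro exI[of _ W]) (auto simp: mono_on_def subset_iff)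
  show ?thesis
  proof (cases "\<exists>x\<in>Y. f x \<in> Z")
    case True
    then have hi: "f x \<in> Z" if "x \<in> A" "x \<notin> Y" for x
      using that Yc Zdown fB by blast
    show ?thesis
    proof (rule cutI[of "{x \<in> Y. f x \<in> Z}"])
      fix x y assume xy: "x \<in> A" "y \<in> A"
        "x \<in> {x \<in> Y. f x \<in> Z} \<longleftrightarrow> y \<in> {x \<in> Y. f x \<in> Z}" "x \<le> y"
      show "g (f x) \<le> g (f y)"
      proof (cases "x \<in> Y \<longleftrightarrow> y \<in> Y")
        case True
        then show ?thesis using xy hi by (intro gmono fB fmono) auto
      next
        case False
        then have "x \<in> Y" "y \<notin> Y" using xy Ydown by blast+
        then show ?thesis using xy hi[of y] Zc[of "f y" "f x"] fB by auto
      qed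
    next
      fix x y assume xy: "x \<in> {x \<in> Y. f x \<in> Z}" "y \<in> A" "y \<notin> {x \<in> Y. f x \<in> Z}"
      show "x \<le> y \<and> g (f y) \<le> g (f x)"
      proof (cases "y \<in> Y")
        case True
        then have "f y \<notin> Z" "\<not> y \<le> x"
          using xy Y(1) Zdown[of "f y" "f x"] fB fmono[of y x] by auto
        then show ?thesis using xy Zc[of "f x" "f y"] fB by auto
      next
        case False
        then show ?thesis using xy Y(1) Yc[of x y] hi[of y] gmono[of "f y" "f x"] fB by auto
      qed
    qed (use Y(1) in auto)
  next
    case False
    then have lo: "f x \<notin> Z" if "x \<in> Y" for x using that by blast
    show ?thesis
    proof (rule cutI[of "Y \<union> {x \<in> A. f x \<in> Z}"])
      fix x y assume xy: "x \<in> A" "y \<in> A"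
        "x \<in> Y \<union> {x \<in> A. f x \<in> Z} \<longleftrightarrow> y \<in> Y \<union> {x \<in> A. f x \<in> Z}" "x \<le> y"
      show "g (f x) \<le> g (f y)"
      proof (cases "x \<in> Y \<longleftrightarrow> y \<in> Y")
        case True
        then show ?thesis using xy lo by (intro gmono fB fmono) auto
      next
        case False
        then have "x \<in> Y" "y \<notin> Y" using xy Ydown by blast+
        then show ?thesis using xy lo[of x] Zc[of "f y" "f x"] fB by auto
      qed
    next
      fix x y assume xy: "x \<in> Y \<union> {x \<in> A. f x \<in> Z}" "y \<in> A" "y \<notin> Y \<union> {x \<in> A. f x \<in> Z}"
      show "x \<le> y \<and> g (f y) \<le> g (f x)"
      proof (cases "x \<in> Y")
        case True
        then show ?thesis using xy Y(1) Yc[of x y] lo[of x] gmono[of "f y" "f x"] fB by auto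
      next
        case False
        then have "\<not> y \<le> x"
          using xy Zdown[of "f y" "f x"] fB fmono[of y x] by auto
        then show ?thesis using False xy Zc[of "f x" "f y"] fB by auto
      qed
    qed (use Y(1) in auto)
  qed
qed

text \<open>The image of the upper piece \<open>A - Y\<close> lies below the image of \<open>Y\<close>, and the two share at most
  one point. Sending the points of \<open>g ` Y\<close> back into \<open>Y\<close> and the remaining, smaller ones into
  \<open>A - Y\<close> swaps the two pieces: the section has a single drop, at the lower end of \<open>g ` Y\<close>.\<close>

lemma cut_monotone_section:
  assumes "cut_monotone A g"
  shows "\<exists>s\<in>g ` A \<rightarrow> A. cut_monotone (g ` A) s \<and> (\<forall>y\<in>g ` A. g (s y) = y)"
proof -
  obtain Y where Y: "Y \<subseteq> A" "mono_on Y g" "mono_on (A - Y) g"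
    and Yc: "\<And>a b. a \<in> Y \<Longrightarrow> b \<in> A \<Longrightarrow> b \<notin> Y \<Longrightarrow> a \<le> b \<and> g b \<le> g a"
    using assms unfolding cut_monotone_def by blast
  define s where "s y = (if y \<in> g ` Y then inv_into Y g y else inv_into (A - Y) g y)" for y
  have sY: "s y \<in> Y \<and> g (s y) = y" if "y \<in> g ` Y" for y
    using that by (simp add: s_def inv_into_into f_inv_into_f)
  have sN: "s y \<in> A \<and> s y \<notin> Y \<and> g (s y) = y" if "y \<in> g ` A" "y \<notin> g ` Y" for y
  proof -
    have "y \<in> g ` (A - Y)" using that by blast
    then show ?thesis
      using that(2) inv_into_into[of y g "A - Y"] f_inv_into_f[of y g "A - Y"] by (simp add: s_def)
  qed
  have gmono: "g x \<le> g y" if "x \<in> A" "y \<in> A" "x \<in> Y \<longleftrightarrow> y \<in> Y" "x \<le> y" for x y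
    using Y that by (auto simp: mono_on_def)
  have mono: "s y \<le> s z" if "y \<in> g ` A" "z \<in> g ` A" "y \<in> g ` Y \<longleftrightarrow> z \<in> g ` Y" "y \<le> z" for y z
  proof (rule ccontr)
    assume gt: "\<not> s y \<le> s z"
    have "s y \<in> A" "s z \<in> A" "s y \<in> Y \<longleftrightarrow> s z \<in> Y" "g (s y) = y" "g (s z) = z"
      using that(1-3) sY sN Y(1) by blast+
    then have "z \<le> y" using gmono[of "s z" "s y"] gt by simp
    then show False using gt \<open>y \<le> z\<close> by simp
  qed
  have "cut_monotone (g ` A) s"
    unfolding cut_monotone_def
  proof (intro exI[of _ "g ` A - g ` Y"] conjI ballI)
    fix a b assume ab: "a \<in> g ` A - g ` Y" "b \<in> g ` A - (g ` A - g ` Y)"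
    then have "s a \<in> A" "s a \<notin> Y" "g (s a) = a" "s b \<in> Y" "g (s b) = b"
      using sN[of a] sY[of b] by auto
    then show "a \<le> b" "s b \<le> s a" using Yc[of "s b" "s a"] by auto
  qed (use mono in \<open>auto simp: mono_on_def\<close>)
  moreover have "s \<in> g ` A \<rightarrow> A" using sY sN Y(1) by blast
  moreover have "\<forall>y\<in>g ` A. g (s y) = y" using sY sN by blast
  ultimately show ?thesis by (intro bexI[of _ s] conjI)
qed

section \<open>Left divisibility and images\<close>

lemma carrier_OP_iff: "f \<in> carrier (OP X) \<longleftrightarrow> f \<in> X \<rightarrow>\<^sub>E X \<and> cut_monotone X f"
  by (simp add: OP_def orientation_preserving_iff_cut_monotone)

lemma mult_OP: "f \<otimes>\<^bsub>OP X\<^esub> g = compose X g f"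
  by (simp add: OP_def)

text \<open>Transformations act on the right, so a left factor \<open>\<delta>\<close> is applied first: it selects
  preimages under \<open>\<beta>\<close>.\<close>

lemma OP_left_multiple_iff:
  assumes \<alpha>: "\<alpha> \<in> carrier (OP X)" and \<beta>: "\<beta> \<in> carrier (OP X)"
  shows "(\<exists>\<delta>\<in>carrier (OP X). \<alpha> = \<delta> \<otimes>\<^bsub>OP X\<^esub> \<beta>) \<longleftrightarrow> \<alpha> ` X \<subseteq> \<beta> ` X"
proof
  assume "\<exists>\<delta>\<in>carrier (OP X). \<alpha> = \<delta> \<otimes>\<^bsub>OP X\<^esub> \<beta>"
  then obtain \<delta> where \<delta>: "\<delta> \<in> X \<rightarrow>\<^sub>E X" "\<alpha> = compose X \<beta> \<delta>"
    by (auto simp: mult_OP carrier_OP_iff)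
  have "\<alpha> x \<in> \<beta> ` X" if "x \<in> X" for x
    using that \<delta> PiE_mem[OF \<delta>(1) that] by (simp add: compose_eq)
  then show "\<alpha> ` X \<subseteq> \<beta> ` X" by blast
next
  assume im: "\<alpha> ` X \<subseteq> \<beta> ` X"
  have ex: "\<alpha> \<in> extensional X" and cm: "cut_monotone X \<alpha>" "cut_monotone X \<beta>"
    using \<alpha> \<beta> by (auto simp: carrier_OP_iff PiE_def)
  obtain s where s: "s \<in> \<beta> ` X \<rightarrow> X" "cut_monotone (\<beta> ` X) s" "\<And>y. y \<in> \<beta> ` X \<Longrightarrow> \<beta> (s y) = y"
    using cut_monotone_section[OF cm(2)] by blast
  define \<delta> where "\<delta> = restrict (s \<circ> \<alpha>) X"
  have "cut_monotone X (s \<circ> \<alpha>)"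
    using cm(1) s(2) im by (intro cut_monotone_comp) auto
  then have "cut_monotone X \<delta>"
    unfolding cut_monotone_def \<delta>_def by (elim ex_forward) (auto simp: mono_on_def subset_iff)
  moreover have "\<delta> \<in> X \<rightarrow>\<^sub>E X" using s(1) im by (fastforce simp: \<delta>_def)
  ultimately have "\<delta> \<in> carrier (OP X)" by (simp add: carrier_OP_iff)
  moreover have "\<alpha> = \<delta> \<otimes>\<^bsub>OP X\<^esub> \<beta>"
    unfolding mult_OP
  proof (rule extensionalityI[OF ex])
    show "compose X \<beta> \<delta> \<in> extensional X" by (simp add: compose_def)
    fix x assume "x \<in> X"
    then show "\<alpha> x = compose X \<beta> \<delta> x"
      using im s(3)[of "\<alpha> x"] by (auto simp: compose_eq \<delta>_def)
  qed
  ultimately show "\<exists>\<delta>\<in>carrier (OP X). \<alpha> = \<delta> \<otimes>\<^bsub>OP X\<^esub> \<beta>" by blast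
qed

section \<open>Green's relations as mutual divisibility\<close>

lemma (in monoid) green_L_iff:
  assumes "a \<in> carrier G" "b \<in> carrier G"
  shows "green_L G a b \<longleftrightarrow>
    (\<exists>u\<in>carrier G. a = u \<otimes> b) \<and> (\<exists>v\<in>carrier G. b = v \<otimes> a)"
proof -
  have sub: "carrier G #> x \<subseteq> carrier G #> y \<longleftrightarrow> (\<exists>u\<in>carrier G. x = u \<otimes> y)"
    if "x \<in> carrier G" "y \<in> carrier G" for x y
  proof
    have "x \<in> carrier G #> x" using that by (auto simp: r_coset_def intro!: bexI[of _ \<one>])
    moreover assume "carrier G #> x \<subseteq> carrier G #> y"
    ultimately show "\<exists>u\<in>carrier G. x = u \<otimes> y" by (auto simp: r_coset_def)
  next
    assume "\<exists>u\<in>carrier G. x = u \<otimes> y"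
    then obtain u where u: "u \<in> carrier G" "x = u \<otimes> y" by blast
    then have "w \<otimes> x = (w \<otimes> u) \<otimes> y" if "w \<in> carrier G" for w
      using that \<open>y \<in> carrier G\<close> by (simp add: m_assoc)
    then show "carrier G #> x \<subseteq> carrier G #> y"
      using u(1) unfolding r_coset_def by blast
  qed
  show ?thesis unfolding green_L_def using assms by (simp add: set_eq_subset sub)
qed

lemma (in monoid) green_R_iff:
  assumes "a \<in> carrier G" "b \<in> carrier G"
  shows "green_R G a b \<longleftrightarrow>
    (\<exists>u\<in>carrier G. a = b \<otimes> u) \<and> (\<exists>v\<in>carrier G. b = a \<otimes> v)"
proof -
  have sub: "x <# carrier G \<subseteq> y <# carrier G \<longleftrightarrow> (\<exists>u\<in>carrier G. x = y \<otimes> u)"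
    if "x \<in> carrier G" "y \<in> carrier G" for x y
  proof
    have "x \<in> x <# carrier G" using that by (auto simp: l_coset_def intro!: bexI[of _ \<one>])
    moreover assume "x <# carrier G \<subseteq> y <# carrier G"
    ultimately show "\<exists>u\<in>carrier G. x = y \<otimes> u" by (auto simp: l_coset_def)
  next
    assume "\<exists>u\<in>carrier G. x = y \<otimes> u"
    then obtain u where u: "u \<in> carrier G" "x = y \<otimes> u" by blast
    then have "x \<otimes> w = y \<otimes> (u \<otimes> w)" if "w \<in> carrier G" for w
      using that \<open>y \<in> carrier G\<close> by (simp add: m_assoc)
    then show "x <# carrier G \<subseteq> y <# carrier G"
      using u(1) unfolding l_coset_def by blast
  qed
  show ?thesis unfolding green_R_def using assms by (simp add: set_eq_subset sub)
qed

lemma green_L_OP_iff: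
  assumes "\<alpha> \<in> carrier (OP X)" "\<beta> \<in> carrier (OP X)"
  shows "green_L (OP X) \<alpha> \<beta> \<longleftrightarrow> \<alpha> ` X = \<beta> ` X"
  using assms by (auto simp: monoid.green_L_iff[OF monoid_OP] OP_left_multiple_iff)

section \<open>The relation \<open>\<D>\<close> and bicompletable bijections\<close>

theorem theorem4p7:
  fixes X :: "'a::linorder set" and \<alpha> \<beta> :: "'a \<Rightarrow> 'a"
  assumes "\<alpha> \<in> carrier (OP X)" and "\<beta> \<in> carrier (OP X)"
  shows "green_D (OP X) \<alpha> \<beta> \<longleftrightarrow> (\<exists>\<theta>. bicompletable X (\<alpha> ` X) (\<beta> ` X) \<theta>)"
proof
  assume "green_D (OP X) \<alpha> \<beta>"
  then obtain \<gamma> where \<gamma>: "\<gamma> \<in> carrier (OP X)" "green_R (OP X) \<alpha> \<gamma>" "\<gamma> ` X = \<beta> ` X"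
    unfolding green_D_def using green_L_OP_iff assms(2) by blast
  then obtain u v where u: "u \<in> carrier (OP X)" "\<alpha> = compose X u \<gamma>"
    and v: "v \<in> carrier (OP X)" "\<gamma> = compose X v \<alpha>"
    using assms(1) by (auto simp: monoid.green_R_iff[OF monoid_OP] mult_OP)
  have uv: "u (\<gamma> x) = \<alpha> x" "v (\<alpha> x) = \<gamma> x" if "x \<in> X" for x
    using that fun_cong[OF u(2), of x] fun_cong[OF v(2), of x] by (simp_all add: compose_def)
  have bij: "bij_betw v (\<alpha> ` X) (\<beta> ` X)"
    by (rule bij_betw_byWitness[where f' = u]) (use uv in \<open>auto simp flip: \<gamma>(3)\<close>)
  have inv: "inv_into (\<alpha> ` X) v y = u y" if "y \<in> \<beta> ` X" for y
    using that bij uv by (intro inv_into_f_eq) (auto simp: bij_betw_def simp flip: \<gamma>(3))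
  have sub: "\<alpha> ` X \<subseteq> X" "\<beta> ` X \<subseteq> X"
    using assms by (auto simp: carrier_OP_iff)
  have "completable X (\<alpha> ` X) (\<beta> ` X) v"
    unfolding completable_def using sub v(1) bij_betw_imp_funcset[OF bij] by blast
  moreover have "completable X (\<beta> ` X) (\<alpha> ` X) (inv_into (\<alpha> ` X) v)"
    unfolding completable_def
    using sub u(1) inv bij_betw_imp_funcset[OF bij_betw_inv_into[OF bij]]
    by (intro conjI bexI[of _ u]) simp_all
  ultimately have "bicompletable X (\<alpha> ` X) (\<beta> ` X) v"
    unfolding bicompletable_def using bij by blast
  then show "\<exists>\<theta>. bicompletable X (\<alpha> ` X) (\<beta> ` X) \<theta>" by (rule exI[of _ v])
next
  assume "\<exists>\<theta>. bicompletable X (\<alpha> ` X) (\<beta> ` X) \<theta>"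
  then obtain \<theta> where "bicompletable X (\<alpha> ` X) (\<beta> ` X) \<theta>"
    by (rule exE)
  then have bij: "bij_betw \<theta> (\<alpha> ` X) (\<beta> ` X)"
    and fwd: "completable X (\<alpha> ` X) (\<beta> ` X) \<theta>"
    and bwd: "completable X (\<beta> ` X) (\<alpha> ` X) (inv_into (\<alpha> ` X) \<theta>)"
    by (simp_all add: bicompletable_def)
  obtain p where p: "p \<in> carrier (OP X)" "\<forall>x\<in>\<alpha> ` X. p x = \<theta> x"
    using fwd unfolding completable_def by (elim conjE bexE)
  obtain q where q: "q \<in> carrier (OP X)" "\<forall>y\<in>\<beta> ` X. q y = inv_into (\<alpha> ` X) \<theta> y"
    using bwd unfolding completable_def by (elim conjE bexE)
  define \<gamma> where "\<gamma> = \<alpha> \<otimes>\<^bsub>OP X\<^esub> p"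
  have \<gamma>: "\<gamma> \<in> carrier (OP X)"
    unfolding \<gamma>_def using monoid.m_closed[OF monoid_OP assms(1) p(1)] .
  have \<gamma>_eq: "\<gamma> x = \<theta> (\<alpha> x)" if "x \<in> X" for x
    using that p(2) by (simp add: \<gamma>_def mult_OP compose_def)
  have "\<gamma> ` X = \<theta> ` \<alpha> ` X" using \<gamma>_eq by (auto simp: image_image)
  then have "\<gamma> ` X = \<beta> ` X" using bij by (simp add: bij_betw_def)
  then have L: "green_L (OP X) \<gamma> \<beta>" using green_L_OP_iff[OF \<gamma> assms(2)] by blast
  have q_eq: "\<alpha> x = q (\<gamma> x)" if "x \<in> X" for x
  proof -
    have "\<theta> (\<alpha> x) \<in> \<beta> ` X" using that bij by (simp add: bij_betw_apply)
    from bspec[OF q(2) this] show ?thesis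
      using that \<gamma>_eq bij_betw_inv_into_left[OF bij, of "\<alpha> x"] by simp
  qed
  have "\<alpha> = \<gamma> \<otimes>\<^bsub>OP X\<^esub> q"
    unfolding mult_OP
  proof (rule extensionalityI)
    show "\<alpha> \<in> extensional X" using assms(1) by (simp add: carrier_OP_iff PiE_def)
    show "compose X q \<gamma> \<in> extensional X" by (simp add: compose_def)
  qed (simp add: compose_eq q_eq)
  then have "green_R (OP X) \<alpha> \<gamma>"
    using monoid.green_R_iff[OF monoid_OP assms(1) \<gamma>] p(1) q(1) \<gamma>_def by blast
  then show "green_D (OP X) \<alpha> \<beta>" unfolding green_D_def using \<gamma> L by blast
qed

end
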